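(* Let $t'\ge 0$ be a constant integer independent of $d$. There exist a constant $c>0$ (possibly depending on $t'$) and an integer $d_0$ such that for every integer $d\ge d_0$, every $d$-dimensional rectilinear drawing of $K_{2d}^d$ whose $2d$ vertices are the vertices of a $d$-dimensional $(\lfloor d/2\rfloor-t')$-neighborly convex polytope has at least $c\,2^d d^{5/2}$ crossing pairs of hyperedges; i.e., the number of crossing pairs is $\Omega(2^d d^{5/2})$.
   Context: $K_{2d}^d$ denotes the complete $d$-uniform hypergraph on $2d$ vertices. A $d$-dimensional rectilinear drawing of it places the vertices at points in general position in $\mathbb{R}^d$ (no $d+1$ on a common affine hyperplane) and draws each hyperedge as the $(d-1)$-simplex spanned by its $d$ vertices. Two hyperedges form a crossing pair if they have no common vertex and their simplices share a point of their relative interiors. For $t\ge1$, a $d$-dimensional convex polytope is $t$-neighborly if every subset of its vertex set with at most $t$ vertices is the vertex set of a face of the polytope. Asymptotic notation is as $d\to\infty$. *)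

theory Defs
  imports "HOL-Analysis.Analysis" "HOL-Analysis.Finite_Function_Topology"
begin

(* The dimension d is quantified inside the theorem, so R^d is modelled as the d-dimensional
   subspace of the normed space of finitely supported real sequences that consists of the
   sequences supported in {..<d}.  The norm of that space is the l1 norm, which induces on this
   subspace the usual topology of R^d, so rel_interior has its usual meaning. *)
definition euclid :: "nat \<Rightarrow> (nat \<Rightarrow>\<^sub>0 real) set" where
  "euclid d = {x. Poly_Mapping.keys x \<subseteq> {..<d}}"

definition affine_hyperplane :: "nat \<Rightarrow> (nat \<Rightarrow>\<^sub>0 real) set \<Rightarrow> bool" where
  "affine_hyperplane d H \<longleftrightarrow>
    (\<exists>a \<in> euclid d. \<exists>b. a \<noteq> 0 \<and>
       H = {x \<in> euclid d. (\<Sum>i<d. Poly_Mapping.lookup a i * Poly_Mapping.lookup x i) = b})"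

definition complete_vertices :: "nat \<Rightarrow> nat set" where
  "complete_vertices d = {..<2 * d}"

definition complete_hyperedges :: "nat \<Rightarrow> nat set set" where
  "complete_hyperedges d = {A. A \<subseteq> complete_vertices d \<and> card A = d}"

definition rectilinear_drawing :: "nat \<Rightarrow> (nat \<Rightarrow> (nat \<Rightarrow>\<^sub>0 real)) \<Rightarrow> bool" where
  "rectilinear_drawing d f \<longleftrightarrow>
    f ` complete_vertices d \<subseteq> euclid d \<and>
    inj_on f (complete_vertices d) \<and>
    (\<forall>I \<subseteq> complete_vertices d. card I = d + 1 \<longrightarrow>
       \<not> (\<exists>H. affine_hyperplane d H \<and> f ` I \<subseteq> H))"

definition hyperedge_simplex :: "(nat \<Rightarrow> (nat \<Rightarrow>\<^sub>0 real)) \<Rightarrow> nat set \<Rightarrow> (nat \<Rightarrow>\<^sub>0 real) set" where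
  "hyperedge_simplex f A = convex hull (f ` A)"

definition crossing :: "(nat \<Rightarrow> (nat \<Rightarrow>\<^sub>0 real)) \<Rightarrow> nat set \<Rightarrow> nat set \<Rightarrow> bool" where
  "crossing f A B \<longleftrightarrow>
    A \<inter> B = {} \<and>
    rel_interior (hyperedge_simplex f A) \<inter> rel_interior (hyperedge_simplex f B) \<noteq> {}"

definition crossing_pairs :: "nat \<Rightarrow> (nat \<Rightarrow> (nat \<Rightarrow>\<^sub>0 real)) \<Rightarrow> nat set set set" where
  "crossing_pairs d f =
    {{A, B} | A B. A \<in> complete_hyperedges d \<and> B \<in> complete_hyperedges d \<and> crossing f A B}"

definition polytope_vertices :: "(nat \<Rightarrow>\<^sub>0 real) set \<Rightarrow> (nat \<Rightarrow>\<^sub>0 real) set" where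
  "polytope_vertices P = {v. v extreme_point_of P}"

(* aff_dim is restricted to euclidean_space; the existential is its definition, unfolded, for
   affine dimension d. *)
definition convex_polytope :: "nat \<Rightarrow> (nat \<Rightarrow>\<^sub>0 real) set \<Rightarrow> bool" where
  "convex_polytope d P \<longleftrightarrow>
    polytope P \<and> P \<subseteq> euclid d \<and>
    (\<exists>B. affine hull B = affine hull P \<and> \<not> affine_dependent B \<and> card B = d + 1)"

definition neighborly :: "nat \<Rightarrow> (nat \<Rightarrow>\<^sub>0 real) set \<Rightarrow> bool" where
  "neighborly t P \<longleftrightarrow>
    (\<forall>S \<subseteq> polytope_vertices P. card S \<le> t \<longrightarrow>
       (\<exists>F. F face_of P \<and> polytope_vertices F = S))"

end

theory Submission
  imports Defs
begin

text \<open>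
  Call one side of a partition \<open>V = A \<union> B\<close> a Radon side if the points of \<open>V\<close> have an affine
  dependence that is positive on \<open>A\<close> and negative on \<open>B\<close>; then the simplices of \<open>A\<close> and \<open>B\<close> meet in
  their relative interiors. Fix a set \<open>V\<close> of \<open>d + 5\<close> vertices. For each 3-subset \<open>Z\<close> of \<open>V\<close>, the
  affine dependence of the other \<open>d + 2\<close> points can be perturbed to take arbitrary signs on \<open>Z\<close>, so
  \<open>Z\<close> is strongly shattered by the family of Radon sides. A family of sets has at least as many
  members as strongly shattered sets, so \<open>V\<close> has at least \<open>(d + 5) choose 3\<close> Radon sides.

  Neighborliness makes each of these partitions balanced up to a constant: a side with at most
  \<open>d div 2 - t'\<close> points would span a face that meets the hull of the other side. Perturbing again,
  the remaining \<open>d - 5\<close> vertices can be distributed arbitrarily over the two sides, and filling both up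
  to \<open>d\<close> vertices can be done in about \<open>2 ^ d / sqrt d\<close> ways. Together this gives
  \<open>d ^ 3 * 2 ^ d / sqrt d\<close> crossing pairs up to a constant factor.
\<close>

section \<open>Strongly shattered sets and the size of a set family\<close>

text \<open>The family contains a full subcube in the directions \<open>S\<close>: one
  \<open>R\<close> serves all \<open>X\<close>. In ordinary shattering the part outside
  \<open>S\<close> may vary with \<open>X\<close>.\<close>

definition strongly_shattered :: "'a set set \<Rightarrow> 'a set \<Rightarrow> bool" where
  "strongly_shattered F S \<longleftrightarrow> (\<exists>R. R \<inter> S = {} \<and> (\<forall>X\<subseteq>S. R \<union> X \<in> F))"

lemma strongly_shattered_subset_Union:
  "strongly_shattered F S \<Longrightarrow> S \<subseteq> \<Union>F"
  unfolding strongly_shattered_def by blast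

text \<open>This is one half of the sandwich theorem for shattering. Induction on the ground set
  splits \<open>F\<close> at a point \<open>x\<close> into the members that avoid \<open>x\<close>
  and those that contain it, the latter with \<open>x\<close> removed. The sizes of \<open>G\<close>
  and \<open>H\<close> add up to that of \<open>F\<close>, so it suffices that the strongly
  shattered sets are subadditive under this split.\<close>

lemma card_strongly_shattered_le:
  assumes "finite U" "F \<subseteq> Pow U"
  shows "card {S. strongly_shattered F S} \<le> card F"
  using assms
proof (induction U arbitrary: F rule: finite_induct)
  case empty
  show ?case
  proof (cases "F = {}")
    case True
    then have "{S. strongly_shattered F S} = {}" by (auto simp: strongly_shattered_def)
    then show ?thesis by simp
  next
    case False
    with empty have "F = {{}}" by auto
    then have "{S. strongly_shattered F S} \<subseteq> {{}}"
      using strongly_shattered_subset_Union[of F] by auto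
    then have "card {S. strongly_shattered F S} \<le> card {{} :: 'a set}"
      by (intro card_mono) auto
    with \<open>F = {{}}\<close> show ?thesis by simp
  qed
next
  case (insert x U)
  define G where "G = {A \<in> F. x \<notin> A}"
  define H where "H = {A. x \<notin> A \<and> insert x A \<in> F}"
  have sub: "G \<subseteq> Pow U" "H \<subseteq> Pow U"
    using insert.prems by (auto simp: G_def H_def)
  have fin: "finite G" "finite H"
    using sub \<open>finite U\<close> by (meson finite_Pow_iff finite_subset)+
  have F: "F = G \<union> insert x ` H"
  proof (intro equalityI subsetI)
    fix A assume "A \<in> F"
    then show "A \<in> G \<union> insert x ` H"
    proof (cases "x \<in> A")
      case True
      then have "A = insert x (A - {x})" by blast
      moreover from this have "A - {x} \<in> H" using \<open>A \<in> F\<close> by (simp add: H_def insert_absorb True)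
      ultimately show ?thesis by blast
    qed (simp add: G_def)
  qed (auto simp: G_def H_def)
  have "card F = card G + card (insert x ` H)"
    unfolding F by (intro card_Un_disjoint) (use fin in \<open>auto simp: G_def\<close>)
  also have "card (insert x ` H) = card H"
    by (intro card_image inj_onI) (auto simp: H_def)
  finally have card_F: "card F = card G + card H" .
  let ?sh = "\<lambda>F. {S. strongly_shattered F S}"
  have "?sh G \<subseteq> Pow U" "?sh H \<subseteq> Pow U"
    using sub strongly_shattered_subset_Union by fast+
  then have finsh: "finite (?sh G)" "finite (?sh H)"
    using \<open>finite U\<close> by (meson finite_Pow_iff finite_subset)+
  \<comment> \<open>A cube of \<open>F\<close> that does not use direction \<open>x\<close> lies in one of \<open>G\<close>, \<open>H\<close>; one that does
    gives the same cube in both.\<close>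
  have "?sh F \<subseteq> (?sh G \<union> ?sh H) \<union> insert x ` (?sh G \<inter> ?sh H)"
  proof
    fix S assume "S \<in> ?sh F"
    then obtain R where R: "R \<inter> S = {}" "\<And>X. X \<subseteq> S \<Longrightarrow> R \<union> X \<in> F"
      by (auto simp: strongly_shattered_def)
    consider "x \<in> S" | "x \<notin> S" "x \<in> R" | "x \<notin> S" "x \<notin> R" by blast
    then show "S \<in> (?sh G \<union> ?sh H) \<union> insert x ` (?sh G \<inter> ?sh H)"
    proof cases
      case 1
      have "R \<union> X \<in> G" if "X \<subseteq> S - {x}" for X
        using R(1) R(2)[of X] that 1 by (auto simp: G_def)
      moreover have "R \<union> X \<in> H" if "X \<subseteq> S - {x}" for X
        using R(1) R(2)[of "insert x X"] that 1 by (auto simp: H_def)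
      ultimately have "S - {x} \<in> ?sh G \<inter> ?sh H"
        using R(1) unfolding strongly_shattered_def by blast
      then show ?thesis
        using 1 by (metis UnI2 image_eqI insert_Diff)
    next
      case 2
      have "(R - {x}) \<union> X \<in> H" if "X \<subseteq> S" for X
      proof -
        have "insert x (R - {x} \<union> X) = R \<union> X" using 2 by auto
        then show ?thesis
          using R(2)[OF that] that 2 by (auto simp: H_def)
      qed
      then have "strongly_shattered H S"
        using R(1) unfolding strongly_shattered_def by (intro exI[of _ "R - {x}"]) auto
      then show ?thesis by blast
    next
      case 3
      have "R \<union> X \<in> G" if "X \<subseteq> S" for X
        using R(2)[OF that] that 3 by (auto simp: G_def)
      then have "strongly_shattered G S"
        using R(1) unfolding strongly_shattered_def by blast
      then show ?thesis by blast
    qed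
  qed
  then have "card (?sh F) \<le> card ((?sh G \<union> ?sh H) \<union> insert x ` (?sh G \<inter> ?sh H))"
    using finsh by (intro card_mono) auto
  \<comment> \<open>Sets in both families are counted once in the union and once more with
    \<open>x\<close> inserted, which matches the inclusion-exclusion identity used next.\<close>
  also have "\<dots> \<le> card (?sh G \<union> ?sh H) + card (?sh G \<inter> ?sh H)"
    using finsh by (meson card_Un_le card_image_le finite_Int add_left_mono le_trans)
  also have "\<dots> = card (?sh G) + card (?sh H)"
    using card_Un_Int[OF finsh] by simp
  also have "\<dots> \<le> card F"
    using insert.IH[OF sub(1)] insert.IH[OF sub(2)] card_F by linarith
  finally show ?case .
qed

section \<open>Linear algebra in the space of finitely supported sequences\<close>

lemma lookup_scaleR [simp]:
  fixes x :: "nat \<Rightarrow>\<^sub>0 real"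
  shows "Poly_Mapping.lookup (r *\<^sub>R x) i = r * Poly_Mapping.lookup x i"
proof -
  have "finite {i. r * Poly_Mapping.lookup x i \<noteq> 0}"
    by (rule finite_subset[OF _ finite_lookup[of x]]) auto
  then show ?thesis by (simp add: scaleR_poly_mapping_def)
qed

lemma euclid_iff: "x \<in> euclid n \<longleftrightarrow> (\<forall>i\<ge>n. Poly_Mapping.lookup x i = 0)"
proof -
  have "x \<in> euclid n \<longleftrightarrow> (\<forall>i. Poly_Mapping.lookup x i \<noteq> 0 \<longrightarrow> i < n)"
    by (simp add: euclid_def subset_iff in_keys_iff)
  then show ?thesis by (metis not_le)
qed

lemma lookup_euclid_eq_0: "x \<in> euclid n \<Longrightarrow> n \<le> i \<Longrightarrow> Poly_Mapping.lookup x i = 0"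
  by (simp add: euclid_iff)

lemma euclidI: "(\<And>i. n \<le> i \<Longrightarrow> Poly_Mapping.lookup x i = 0) \<Longrightarrow> x \<in> euclid n"
  by (simp add: euclid_iff)

lemma euclid_expansion:
  assumes "x \<in> euclid n"
  shows "x = (\<Sum>i<n. Poly_Mapping.lookup x i *\<^sub>R Poly_Mapping.single i 1)"
proof (rule poly_mapping_eqI)
  fix k
  show "Poly_Mapping.lookup x k =
      Poly_Mapping.lookup (\<Sum>i<n. Poly_Mapping.lookup x i *\<^sub>R Poly_Mapping.single i 1) k"
    using lookup_euclid_eq_0[OF assms, of k]
    by (cases "k < n") (simp_all add: lookup_sum lookup_single when_def if_distrib cong: if_cong)
qed

lemma single_one_inj:
  "Poly_Mapping.single i (1::real) = Poly_Mapping.single j 1 \<longleftrightarrow> i = j"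
  by (metis lookup_single_eq lookup_single_not_eq zero_neq_one)

lemma subspace_euclid: "subspace (euclid n)"
  by (simp add: subspace_def euclid_iff lookup_add)

lemma euclid_subset_span: "euclid n \<subseteq> span ((\<lambda>i. Poly_Mapping.single i 1) ` {..<n})"
proof
  fix x assume "x \<in> euclid n"
  then show "x \<in> span ((\<lambda>i. Poly_Mapping.single i 1) ` {..<n})"
    by (subst euclid_expansion, assumption) (intro span_sum span_scale span_base imageI)
qed

lemma linear_euclid:
  fixes \<phi> :: "(nat \<Rightarrow>\<^sub>0 real) \<Rightarrow> real"
  assumes "linear \<phi>" "x \<in> euclid n"
  shows "\<phi> x = (\<Sum>i<n. Poly_Mapping.lookup x i * \<phi> (Poly_Mapping.single i 1))"
proof -
  have "\<phi> x = \<phi> (\<Sum>i<n. Poly_Mapping.lookup x i *\<^sub>R Poly_Mapping.single i 1)"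
    using euclid_expansion[OF assms(2)] by simp
  also have "\<dots> = (\<Sum>i<n. Poly_Mapping.lookup x i * \<phi> (Poly_Mapping.single i 1))"
    using assms(1) by (simp add: linear_sum linear_cmul)
  finally show ?thesis .
qed

lemma norm_euclid:
  assumes "(x :: nat \<Rightarrow>\<^sub>0 real) \<in> euclid n"
  shows "norm x = (\<Sum>i<n. \<bar>Poly_Mapping.lookup x i\<bar>)"
proof -
  have "norm x = (\<Sum>i\<in>Poly_Mapping.keys x. \<bar>Poly_Mapping.lookup x i\<bar>)"
    by (simp add: norm_poly_mapping_def dist_poly_mapping_def)
  also have "\<dots> = (\<Sum>i<n. \<bar>Poly_Mapping.lookup x i\<bar>)"
    using assms by (intro sum.mono_neutral_left) (simp_all add: euclid_def in_keys_iff)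
  finally show ?thesis .
qed

text \<open>A linear functional on the whole space can be unbounded, but on \<open>euclid n\<close>
  only its values at finitely many unit vectors matter. The bound later controls barycentric
  coordinates.\<close>

lemma linear_bounded_on_euclid:
  fixes \<phi> :: "(nat \<Rightarrow>\<^sub>0 real) \<Rightarrow> real"
  assumes "linear \<phi>"
  obtains M where "M > 0" "\<And>x. x \<in> euclid n \<Longrightarrow> \<bar>\<phi> x\<bar> \<le> M * norm x"
proof
  define M where "M = 1 + (\<Sum>i<n. \<bar>\<phi> (Poly_Mapping.single i 1)\<bar>)"
  show "M > 0" unfolding M_def by (simp add: add_pos_nonneg sum_nonneg)
  show "\<bar>\<phi> x\<bar> \<le> M * norm x" if x: "x \<in> euclid n" for x
  proof -
    have "\<bar>\<phi> (Poly_Mapping.single i 1)\<bar> \<le> M" if "i < n" for i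
      using member_le_sum[of i "{..<n}" "\<lambda>i. \<bar>\<phi> (Poly_Mapping.single i 1)\<bar>"] that
      unfolding M_def by simp
    then have "(\<Sum>i<n. \<bar>Poly_Mapping.lookup x i * \<phi> (Poly_Mapping.single i 1)\<bar>)
        \<le> (\<Sum>i<n. M * \<bar>Poly_Mapping.lookup x i\<bar>)"
      by (intro sum_mono) (simp add: abs_mult mult.commute[of M] mult_left_mono)
    then show ?thesis
      unfolding linear_euclid[OF assms x] norm_euclid[OF x] sum_distrib_left
      by (rule order_trans[OF sum_abs])
  qed
qed

text \<open>Points are indexed by vertices throughout, whereas \<open>dependent\<close> speaks of
  sets. Injectivity lets coefficients be carried along \<open>g\<close> in one direction and along
  its inverse in the other.\<close>

lemma dependent_image_iff:
  fixes g :: "'i \<Rightarrow> 'a::real_vector"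
  assumes "finite A" "inj_on g A"
  shows "dependent (g ` A) \<longleftrightarrow> (\<exists>u. (\<exists>i\<in>A. u i \<noteq> 0) \<and> (\<Sum>i\<in>A. u i *\<^sub>R g i) = 0)"
proof
  assume "dependent (g ` A)"
  then obtain u where u: "\<exists>v\<in>g ` A. u v \<noteq> 0" "(\<Sum>v\<in>g ` A. u v *\<^sub>R v) = 0"
    unfolding dependent_finite[OF finite_imageI[OF assms(1), of g]] by (elim exE conjE)
  have "(\<Sum>i\<in>A. u (g i) *\<^sub>R g i) = 0"
    using u(2) assms(2) by (simp add: sum.reindex)
  with u(1) show "\<exists>u. (\<exists>i\<in>A. u i \<noteq> 0) \<and> (\<Sum>i\<in>A. u i *\<^sub>R g i) = 0"
    by (intro exI[of _ "\<lambda>i. u (g i)"]) blast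
next
  assume "\<exists>u. (\<exists>i\<in>A. u i \<noteq> 0) \<and> (\<Sum>i\<in>A. u i *\<^sub>R g i) = 0"
  then obtain l where l: "\<exists>i\<in>A. l i \<noteq> 0" "(\<Sum>i\<in>A. l i *\<^sub>R g i) = 0" by blast
  have "(\<Sum>v\<in>g ` A. l (inv_into A g v) *\<^sub>R v) = 0"
    using l(2) assms(2) by (simp add: sum.reindex)
  moreover have "\<exists>v\<in>g ` A. l (inv_into A g v) \<noteq> 0"
    using l(1) assms(2) by auto
  ultimately show "dependent (g ` A)"
    unfolding dependent_finite[OF finite_imageI[OF assms(1), of g]]
    by (intro exI[of _ "\<lambda>v. l (inv_into A g v)"]) blast
qed

text \<open>Adding \<open>x\<close> to a basis of the span keeps it independent, so the functional
  can be prescribed there and extended linearly.\<close>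

lemma linear_separates_span:
  fixes S :: "'a::real_vector set"
  assumes "x \<notin> span S"
  obtains \<phi> :: "'a \<Rightarrow> real" where "linear \<phi>" "\<And>y. y \<in> span S \<Longrightarrow> \<phi> y = 0" "\<phi> x = 1"
proof -
  obtain B where B: "B \<subseteq> span S" "independent B" "span S \<subseteq> span B"
    by (rule basis_exists)
  have "x \<notin> span B"
    using assms B(1) span_minimal[OF B(1)] by auto
  then have "independent (insert x B)"
    using B(2) independent_insertI by blast
  then obtain \<phi> where \<phi>: "linear \<phi>" "\<forall>y\<in>insert x B. \<phi> y = (if y = x then 1 else 0 :: real)"
    using linear_independent_extend[of "insert x B" "\<lambda>y. if y = x then 1 else 0"] by blast
  have "\<phi> y = 0" if "y \<in> span S" for y
  proof (rule linear_eq_0_on_span[OF \<phi>(1)])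
    show "y \<in> span B" using that B(3) by blast
    show "\<phi> z = 0" if "z \<in> B" for z
      using \<phi>(2) that \<open>x \<notin> span B\<close> span_base by auto
  qed
  then show thesis using that \<phi> by auto
qed

section \<open>Affine dependences and general position\<close>

definition affine_dependence :: "('i \<Rightarrow> 'a::real_vector) \<Rightarrow> 'i set \<Rightarrow> ('i \<Rightarrow> real) \<Rightarrow> bool" where
  "affine_dependence f U u \<longleftrightarrow> (\<Sum>i\<in>U. u i) = 0 \<and> (\<Sum>i\<in>U. u i *\<^sub>R f i) = 0"

text \<open>Coordinate \<open>d\<close> is the first one that vanishes on \<open>euclid d\<close>.
  Setting it to 1 turns affine dependences into linear ones, because it records the sum of the
  coefficients.\<close>

definition homogenize :: "nat \<Rightarrow> (nat \<Rightarrow>\<^sub>0 real) \<Rightarrow> (nat \<Rightarrow>\<^sub>0 real)" where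
  "homogenize d v = v + Poly_Mapping.single d 1"

lemma homogenize_in_euclid: "v \<in> euclid d \<Longrightarrow> homogenize d v \<in> euclid (Suc d)"
  by (simp add: euclid_iff homogenize_def lookup_add lookup_single)

lemma homogenize_eq_iff [simp]: "homogenize d v = homogenize d w \<longleftrightarrow> v = w"
  by (simp add: homogenize_def)

lemma sum_homogenize:
  "(\<Sum>i\<in>U. u i *\<^sub>R homogenize d (f i)) = (\<Sum>i\<in>U. u i *\<^sub>R f i) + (\<Sum>i\<in>U. u i) *\<^sub>R Poly_Mapping.single d 1"
  by (simp add: homogenize_def scaleR_add_right sum.distrib scaleR_sum_left)

lemma affine_dependence_homogenize:
  assumes "f ` U \<subseteq> euclid d"
  shows "affine_dependence f U u \<longleftrightarrow> (\<Sum>i\<in>U. u i *\<^sub>R homogenize d (f i)) = 0"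
proof
  assume *: "(\<Sum>i\<in>U. u i *\<^sub>R homogenize d (f i)) = 0"
  have "Poly_Mapping.lookup (\<Sum>i\<in>U. u i *\<^sub>R homogenize d (f i)) d = (\<Sum>i\<in>U. u i)"
    unfolding lookup_sum
    by (intro sum.cong) (use assms in \<open>auto simp: homogenize_def lookup_add lookup_euclid_eq_0 image_subset_iff\<close>)
  then have "(\<Sum>i\<in>U. u i) = 0" using * by simp
  then show "affine_dependence f U u"
    using * by (simp add: affine_dependence_def sum_homogenize)
qed (simp add: affine_dependence_def sum_homogenize)

text \<open>The lifted points are \<open>d + 2\<close> vectors in a space of dimension
  \<open>d + 1\<close>.\<close>

lemma affine_dependence_exists:
  assumes "finite C" "inj_on f C" "f ` C \<subseteq> euclid d" "card C = d + 2"
  obtains u where "affine_dependence f C u" "\<exists>i\<in>C. u i \<noteq> 0"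
proof -
  let ?g = "\<lambda>i. homogenize d (f i)"
  let ?E = "(\<lambda>i. Poly_Mapping.single i (1::real)) ` {..<Suc d}"
  have inj: "inj_on ?g C" using assms(2) by (auto simp: inj_on_def)
  have "?g ` C \<subseteq> span ?E"
    using homogenize_in_euclid euclid_subset_span assms(3) by blast
  moreover have "card ?E \<le> d + 1"
    using card_image_le[of "{..<Suc d}"] by simp
  moreover have "card (?g ` C) = d + 2" using inj assms(4) by (simp add: card_image)
  ultimately have "dependent (?g ` C)"
    using independent_span_bound[of ?E "?g ` C"] by fastforce
  then show thesis
    using that dependent_image_iff[OF assms(1) inj] affine_dependence_homogenize[OF assms(3)] by auto
qed

definition general_position :: "nat \<Rightarrow> ('i \<Rightarrow> 'a::real_vector) \<Rightarrow> 'i set \<Rightarrow> bool" where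
  "general_position d f U \<longleftrightarrow> (\<forall>I u. I \<subseteq> U \<and> card I \<le> d + 1 \<and> affine_dependence f I u \<longrightarrow> (\<forall>i\<in>I. u i = 0))"

text \<open>A nontrivial dependence makes one lifted point redundant, so the lifts span a proper
  subspace of \<open>euclid (Suc d)\<close>. A nonzero functional that vanishes on this subspace is
  the equation of the hyperplane.\<close>

lemma dependence_in_hyperplane:
  assumes I: "finite I" "card I = d + 1" "f ` I \<subseteq> euclid d"
    and dep: "affine_dependence f I u" "k \<in> I" "u k \<noteq> 0"
  shows "\<exists>H. affine_hyperplane d H \<and> f ` I \<subseteq> H"
proof -
  let ?g = "\<lambda>i. homogenize d (f i)"
  let ?e = "\<lambda>i. Poly_Mapping.single i (1::real)"
  have "(\<Sum>i\<in>I. u i *\<^sub>R ?g i) = 0"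
    using dep(1) affine_dependence_homogenize[OF I(3)] by blast
  then have eq: "u k *\<^sub>R ?g k = - (\<Sum>i\<in>I - {k}. u i *\<^sub>R ?g i)"
    using I(1) dep(2) by (simp add: sum.remove eq_neg_iff_add_eq_0)
  have "u k *\<^sub>R ?g k \<in> span (?g ` (I - {k}))"
    unfolding eq by (intro span_neg span_sum span_scale span_base) auto
  then have "?g k \<in> span (?g ` (I - {k}))"
    using dep(3) span_scale[of "u k *\<^sub>R ?g k" _ "1 / u k"] by simp
  then have in_span: "?g i \<in> span (?g ` (I - {k}))" if "i \<in> I" for i
    using that by (cases "i = k") (auto intro: span_base)
  \<comment> \<open>The at most \<open>d\<close> lifts other than that of \<open>k\<close> cannot
    span all \<open>d + 1\<close> independent unit vectors.\<close>
  have "\<exists>j<Suc d. ?e j \<notin> span (?g ` (I - {k}))"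
  proof (rule ccontr)
    assume "\<not> ?thesis"
    then have "?e ` {..<Suc d} \<subseteq> span (?g ` (I - {k}))" by auto
    moreover have "independent (?e ` {..<Suc d})"
    proof -
      have "inj_on ?e {..<Suc d}" by (rule inj_onI) (simp add: single_one_inj)
      moreover have "u j = 0" if "(\<Sum>i<Suc d. u i *\<^sub>R ?e i) = 0" "j < Suc d" for u j
      proof -
        have "Poly_Mapping.lookup (\<Sum>i<Suc d. u i *\<^sub>R ?e i) j = u j"
          unfolding lookup_sum using that(2) by (simp add: lookup_single when_def if_distrib cong: if_cong del: sum.lessThan_Suc)
        then show ?thesis using that by simp
      qed
      ultimately show ?thesis
        using dependent_image_iff[of "{..<Suc d}" ?e] by (metis finite_lessThan lessThan_iff)
    qed
    ultimately have "card (?e ` {..<Suc d}) \<le> card (?g ` (I - {k}))"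
      using independent_span_bound[of "?g ` (I - {k})"] I(1) by blast
    moreover have "card (?e ` {..<Suc d}) = Suc d"
      by (simp add: card_image inj_on_def single_one_inj)
    moreover have "card (?g ` (I - {k})) \<le> d"
      using card_image_le[of "I - {k}" ?g] I(1,2) dep(2) by simp
    ultimately show False by simp
  qed
  then obtain j where j: "j < Suc d" "?e j \<notin> span (?g ` (I - {k}))" by blast
  obtain \<phi> :: "(nat \<Rightarrow>\<^sub>0 real) \<Rightarrow> real" where \<phi>: "linear \<phi>" "\<And>y. y \<in> span (?g ` (I - {k})) \<Longrightarrow> \<phi> y = 0" "\<phi> (?e j) = 1"
    using linear_separates_span[OF j(2)] by blast
  \<comment> \<open>The first \<open>d\<close> coefficients of the functional form the normal
    vector; its value at the extra coordinate supplies the constant term.\<close>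
  define a where "a = (\<Sum>i<d. \<phi> (?e i) *\<^sub>R ?e i)"
  define b where "b = - \<phi> (?e d)"
  have lookup_a: "Poly_Mapping.lookup a i = (if i < d then \<phi> (?e i) else 0)" for i
    unfolding a_def by (simp add: lookup_sum lookup_single when_def if_distrib cong: if_cong)
  have a: "a \<in> euclid d" by (rule euclidI) (simp add: lookup_a)
  have on: "(\<Sum>l<d. Poly_Mapping.lookup a l * Poly_Mapping.lookup (f i) l) = b" if "i \<in> I" for i
  proof -
    have "f i \<in> euclid d" using I(3) that by blast
    then have "\<phi> (f i) = (\<Sum>l<d. Poly_Mapping.lookup a l * Poly_Mapping.lookup (f i) l)"
      using linear_euclid[OF \<phi>(1)] by (simp add: lookup_a mult.commute)
    moreover have "\<phi> (f i) + \<phi> (?e d) = 0"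
      using \<phi>(2)[OF in_span[OF that]] \<phi>(1) by (simp add: homogenize_def linear_add)
    ultimately show ?thesis by (simp add: b_def)
  qed
  \<comment> \<open>With zero normal, the equation at any point of \<open>I\<close> gives
    \<open>b = 0\<close>. The functional would then vanish on every unit vector, against its value 1
    at \<open>?e j\<close>.\<close>
  have "a \<noteq> 0"
  proof
    assume "a = 0"
    then have "\<phi> (?e d) = 0" using on[OF dep(2)] by (simp add: b_def)
    moreover have "\<phi> (?e i) = 0" if "i < d" for i
      using lookup_a[of i] that \<open>a = 0\<close> by simp
    ultimately show False using \<phi>(3) j(1) by (metis less_SucE zero_neq_one)
  qed
  let ?H = "{x \<in> euclid d. (\<Sum>l<d. Poly_Mapping.lookup a l * Poly_Mapping.lookup x l) = b}"
  have "affine_hyperplane d ?H"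
    unfolding affine_hyperplane_def using a \<open>a \<noteq> 0\<close> by (intro bexI[of _ a] exI[of _ b]) simp
  moreover have "f ` I \<subseteq> ?H" using on I(3) by auto
  ultimately show ?thesis by (intro exI[of _ ?H]) simp
qed

text \<open>The drawing restricts only sets of exactly \<open>d + 1\<close> vertices. A smaller
  \<open>J\<close> is padded with zero coefficients, and \<open>d \<ge> 1\<close> ensures that there
  are \<open>d + 1\<close> vertices.\<close>

lemma rectilinear_drawing_general_position:
  assumes "rectilinear_drawing d f" "d \<ge> 1"
  shows "general_position d f (complete_vertices d)"
  unfolding general_position_def
proof (intro allI impI ballI, elim conjE)
  fix J u k
  assume J: "J \<subseteq> complete_vertices d" "card J \<le> d + 1" "affine_dependence f J u" "k \<in> J"
  have "\<exists>I. J \<subseteq> I \<and> I \<subseteq> complete_vertices d \<and> card I = d + 1"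
    using exists_subset_between[of J "d + 1" "complete_vertices d"] J assms(2)
    by (auto simp: complete_vertices_def)
  then obtain I where I: "J \<subseteq> I" "I \<subseteq> complete_vertices d" "card I = d + 1" by blast
  have finI: "finite I" using I(2) finite_subset by (auto simp: complete_vertices_def)
  define \<mu> where "\<mu> i = (if i \<in> J then u i else 0)" for i
  have "affine_dependence f I \<mu>"
  proof -
    have "(\<Sum>i\<in>I. \<mu> i) = (\<Sum>i\<in>J. u i)" "(\<Sum>i\<in>I. \<mu> i *\<^sub>R f i) = (\<Sum>i\<in>J. u i *\<^sub>R f i)"
      using finI I(1) by (auto intro!: sum.mono_neutral_cong_right simp: \<mu>_def)
    then show ?thesis using J(3) by (simp add: affine_dependence_def)
  qed
  moreover have "f ` I \<subseteq> euclid d" "\<not> (\<exists>H. affine_hyperplane d H \<and> f ` I \<subseteq> H)"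
    using assms(1) I unfolding rectilinear_drawing_def by blast+
  ultimately have "\<mu> k = 0"
    using dependence_in_hyperplane[OF finI I(3), of f \<mu> k] I(1) J(4) by blast
  then show "u k = 0" using J(4) by (simp add: \<mu>_def)
qed

section \<open>Radon sides and the convex combinations they produce\<close>

text \<open>In terms of the Gale transform, these are the dichotomies cut out by linear hyperplanes
  that avoid all the vectors.\<close>

definition radon_sides :: "('i \<Rightarrow> 'a::real_vector) \<Rightarrow> 'i set \<Rightarrow> 'i set set" where
  "radon_sides f U =
    {A. A \<subseteq> U \<and> (\<exists>u. affine_dependence f U u \<and> (\<forall>i\<in>A. u i > 0) \<and> (\<forall>i\<in>U - A. u i < 0))}"

lemma affine_dependence_mono_neutral:
  assumes "finite U" "I \<subseteq> U" "\<And>i. i \<in> U - I \<Longrightarrow> u i = 0"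
  shows "affine_dependence f U u \<longleftrightarrow> affine_dependence f I u"
proof -
  have "(\<Sum>i\<in>U. u i) = (\<Sum>i\<in>I. u i)" "(\<Sum>i\<in>U. u i *\<^sub>R f i) = (\<Sum>i\<in>I. u i *\<^sub>R f i)"
    using assms by (auto intro!: sum.mono_neutral_right)
  then show ?thesis by (simp add: affine_dependence_def)
qed

lemma affine_dependence_cong:
  assumes "\<And>i. i \<in> U \<Longrightarrow> u i = v i"
  shows "affine_dependence f U u \<longleftrightarrow> affine_dependence f U v"
  using assms by (simp add: affine_dependence_def)

lemma affine_dependence_scale:
  "affine_dependence f U u \<Longrightarrow> affine_dependence f U (\<lambda>i. c * u i)"
  unfolding affine_dependence_def
  by (simp flip: sum_distrib_left scaleR_scaleR scaleR_sum_right)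

lemma affine_dependence_add:
  "affine_dependence f U u \<Longrightarrow> affine_dependence f U v \<Longrightarrow> affine_dependence f U (\<lambda>i. u i + v i)"
  by (simp add: affine_dependence_def sum.distrib scaleR_add_left)

lemma radon_sides_complement:
  assumes "A \<in> radon_sides f U"
  shows "U - A \<in> radon_sides f U"
proof -
  obtain u where u: "A \<subseteq> U" "affine_dependence f U u" "\<forall>i\<in>A. u i > 0" "\<forall>i\<in>U - A. u i < 0"
    using assms by (auto simp: radon_sides_def)
  have "affine_dependence f U (\<lambda>i. - u i)"
    using affine_dependence_scale[OF u(2), of "-1"] by simp
  then show ?thesis
    using u(1,3,4) unfolding radon_sides_def by fastforce
qed

text \<open>The positive and negative coefficients have equal total weight, so dividing by this
  weight turns both parts into convex combinations of the same point. The weight is nonzero because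
  negative coefficients alone cannot sum to zero.\<close>

lemma radon_sides_convex_combinations:
  assumes "finite U" "U \<noteq> {}" "A \<in> radon_sides f U"
  obtains a b where "\<forall>i\<in>A. a i > 0" "sum a A = 1"
    "\<forall>i\<in>U - A. b i > (0::real)" "sum b (U - A) = 1"
    "(\<Sum>i\<in>A. a i *\<^sub>R f i) = (\<Sum>i\<in>U - A. b i *\<^sub>R f i)"
proof -
  obtain u where u: "A \<subseteq> U" "affine_dependence f U u" "\<And>i. i \<in> A \<Longrightarrow> u i > 0" "\<And>i. i \<in> U - A \<Longrightarrow> u i < 0"
    using assms(3) by (auto simp: radon_sides_def)
  have fin: "finite A" "finite (U - A)" using assms(1) u(1) finite_subset by auto
  have sum0: "sum u A + sum u (U - A) = 0"
    using u(2) sum.subset_diff[OF u(1) assms(1), of u] by (simp add: affine_dependence_def)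
  have vec0: "(\<Sum>i\<in>A. u i *\<^sub>R f i) + (\<Sum>i\<in>U - A. u i *\<^sub>R f i) = 0"
    using u(2) sum.subset_diff[OF u(1) assms(1), of "\<lambda>i. u i *\<^sub>R f i"]
    by (simp add: affine_dependence_def add.commute)
  have "A \<noteq> {}"
  proof
    assume "A = {}"
    then have "sum u U < 0" using u(4) assms(1,2) sum_strict_mono[of U u "\<lambda>_. 0"] by simp
    then show False using u(2) by (simp add: affine_dependence_def)
  qed
  define s where "s = sum u A"
  have s: "s > 0" unfolding s_def using \<open>A \<noteq> {}\<close> fin u(3) by (simp add: sum_pos)
  show thesis
  proof
    show "\<forall>i\<in>A. u i / s > 0" using s u(3) by simp
    show "\<forall>i\<in>U - A. - u i / s > 0" using s u(4) by (simp add: divide_neg_pos)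
    show "(\<Sum>i\<in>A. u i / s) = 1"
      using s by (simp add: s_def flip: sum_divide_distrib)
    have "sum u (U - A) = - s" using sum0 by (simp add: s_def)
    then show "(\<Sum>i\<in>U - A. - u i / s) = 1"
      using s by (simp add: sum_negf flip: sum_divide_distrib)
    have "(\<Sum>i\<in>A. (u i / s) *\<^sub>R f i) = (1 / s) *\<^sub>R (\<Sum>i\<in>A. u i *\<^sub>R f i)"
      by (simp add: scaleR_sum_right)
    also have "(\<Sum>i\<in>A. u i *\<^sub>R f i) = - (\<Sum>i\<in>U - A. u i *\<^sub>R f i)"
      using vec0 by (simp add: eq_neg_iff_add_eq_0)
    also have "(1 / s) *\<^sub>R \<dots> = (\<Sum>i\<in>U - A. (- u i / s) *\<^sub>R f i)"
      by (simp add: scaleR_sum_right sum_negf)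
    finally show "(\<Sum>i\<in>A. (u i / s) *\<^sub>R f i) = (\<Sum>i\<in>U - A. (- u i / s) *\<^sub>R f i)" .
  qed
qed

section \<open>Perturbing and counting Radon sides in general position\<close>

locale points_in_general_position =
  fixes d :: nat and f :: "nat \<Rightarrow> (nat \<Rightarrow>\<^sub>0 real)" and N :: "nat set"
  assumes finite_N: "finite N"
    and inj: "inj_on f N"
    and in_euclid: "f ` N \<subseteq> euclid d"
    and gen_pos: "general_position d f N"
begin

lemma finite_subset_N: "I \<subseteq> N \<Longrightarrow> finite I"
  by (rule finite_subset[OF _ finite_N])

lemma trivial_dependence:
  "I \<subseteq> N \<Longrightarrow> card I \<le> d + 1 \<Longrightarrow> affine_dependence f I u \<Longrightarrow> i \<in> I \<Longrightarrow> u i = 0"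
  using gen_pos unfolding general_position_def by blast

text \<open>A vanishing coefficient would leave a nontrivial dependence on \<open>d + 1\<close>
  points, which general position forbids.\<close>

lemma circuit_exists:
  assumes "C \<subseteq> N" "card C = d + 2"
  obtains u where "affine_dependence f C u" "\<And>i. i \<in> C \<Longrightarrow> u i \<noteq> 0"
proof -
  have finC: "finite C" using assms(1) by (rule finite_subset_N)
  have "inj_on f C" "f ` C \<subseteq> euclid d"
    using inj in_euclid assms(1) by (auto intro: inj_on_subset)
  then obtain u where u: "affine_dependence f C u" "\<exists>i\<in>C. u i \<noteq> 0"
    using affine_dependence_exists[OF finC _ _ assms(2)] by blast
  have "u i \<noteq> 0" if i: "i \<in> C" for i
  proof
    assume "u i = 0"
    then have "affine_dependence f (C - {i}) u"
      using u(1) affine_dependence_mono_neutral[OF finC, of "C - {i}" u f] by auto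
    moreover have "card (C - {i}) \<le> d + 1" using assms(2) i finC by simp
    ultimately have "\<forall>k\<in>C - {i}. u k = 0"
      using trivial_dependence[of "C - {i}" u] assms(1) by blast
    with \<open>u i = 0\<close> u(2) show False by auto
  qed
  then show thesis using that u(1) by blast
qed

text \<open>A small multiple of a dependence with nonzero coefficient at \<open>j\<close> is added
  to the given one. The signs on \<open>C\<close> survive and the sign at \<open>j\<close> is
  free.\<close>

lemma radon_sides_insert:
  assumes C: "C \<subseteq> N" "d + 1 \<le> card C" and j: "j \<in> N" "j \<notin> C" and A: "A \<in> radon_sides f C"
  shows "A \<in> radon_sides f (insert j C)" "insert j A \<in> radon_sides f (insert j C)"
proof -
  have finC: "finite C" using C(1) by (rule finite_subset_N)
  obtain u where u: "A \<subseteq> C" "affine_dependence f C u" "\<And>i. i \<in> A \<Longrightarrow> u i > 0" "\<And>i. i \<in> C - A \<Longrightarrow> u i < 0"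
    using A by (auto simp: radon_sides_def)
  obtain I where I: "I \<subseteq> C" "card I = d + 1" "finite I"
    using obtain_subset_with_card_n[OF C(2)] .
  have "j \<notin> I" using I(1) j(2) by blast
  then have card: "card (insert j I) = d + 2" using I by simp
  have sub: "insert j I \<subseteq> N" using I C j by blast
  obtain w where w: "affine_dependence f (insert j I) w" "\<And>i. i \<in> insert j I \<Longrightarrow> w i \<noteq> 0"
    using circuit_exists[OF sub card] by blast
  \<comment> \<open>The circuit through \<open>j\<close> is scaled to have coefficient 1 there and
    extended by zero to the rest of \<open>C\<close>.\<close>
  define v where "v i = (if i \<in> insert j I then w i / w j else 0)" for i
  have "affine_dependence f (insert j I) v"
    using affine_dependence_scale[OF w(1), of "1 / w j"]
    by (subst affine_dependence_cong[where v = "\<lambda>i. 1 / w j * w i"]) (simp_all add: v_def)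
  then have v: "affine_dependence f (insert j C) v"
    using finC I(1) by (subst affine_dependence_mono_neutral[where I = "insert j I"]) (auto simp: v_def)
  have vj: "v j = 1" using w(2)[of j] by (simp add: v_def)
  define u' where "u' i = (if i = j then 0 else u i)" for i
  have "affine_dependence f C u'"
    using u(2) j(2) by (subst affine_dependence_cong[where v = u]) (auto simp: u'_def)
  then have u': "affine_dependence f (insert j C) u'"
    using finC by (subst affine_dependence_mono_neutral[where I = C]) (auto simp: u'_def)
  \<comment> \<open>Positivity of the product says that the perturbed coefficient keeps its sign. As
    \<open>e\<close> tends to 0 the product tends to the square of \<open>u i\<close>, so all the
    finitely many conditions hold for small \<open>e\<close>.\<close>
  have perturb: "\<exists>e>0. \<forall>i\<in>C. 0 < u i * (u i + e * s * v i)" for s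
  proof -
    have "\<forall>\<^sub>F e in at_right 0. 0 < u i * (u i + e * s * v i)" if "i \<in> C" for i
    proof -
      have "((\<lambda>e. u i * (u i + e * s * v i)) \<longlongrightarrow> u i * (u i + 0 * s * v i)) (at_right 0)"
        by (intro tendsto_intros)
      moreover have "u i * (u i + 0 * s * v i) > 0"
        using u(3,4)[of i] that by (cases "i \<in> A") (auto simp: zero_less_mult_iff)
      ultimately show ?thesis by (rule order_tendstoD)
    qed
    then have "\<forall>\<^sub>F e in at_right 0. \<forall>i\<in>C. 0 < u i * (u i + e * s * v i)"
      using finC by (simp add: eventually_ball_finite)
    moreover have "\<forall>\<^sub>F e in at_right 0. e > (0::real)" by (rule eventually_at_right_less)
    ultimately have "\<forall>\<^sub>F e in at_right 0. e > 0 \<and> (\<forall>i\<in>C. 0 < u i * (u i + e * s * v i))"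
      by eventually_elim auto
    then show ?thesis using eventually_happens'[OF trivial_limit_at_right_real] by blast
  qed
  have sign: "\<exists>p. affine_dependence f (insert j C) p \<and> (\<forall>i\<in>A. p i > 0) \<and> (\<forall>i\<in>C - A. p i < 0) \<and> 0 < s * p j"
    if "s \<noteq> 0" for s
  proof -
    obtain e where e: "e > 0" "\<And>i. i \<in> C \<Longrightarrow> 0 < u i * (u i + e * s * v i)"
      using perturb[of s] by blast
    let ?p = "\<lambda>i. u' i + (e * s) * v i"
    have "affine_dependence f (insert j C) ?p"
      by (intro affine_dependence_add affine_dependence_scale u' v)
    moreover have "?p i = u i + e * s * v i" if "i \<in> C" for i
      using that j(2) by (auto simp: u'_def)
    then have "?p i > 0" if "i \<in> A" for i
      using e(2)[of i] u(3)[OF that] u(1) that by (auto simp: zero_less_mult_iff)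
    moreover have "?p i < 0" if "i \<in> C - A" for i
      using e(2)[of i] u(4)[OF that] that j(2) by (auto simp: zero_less_mult_iff u'_def)
    moreover have "0 < s * ?p j"
    proof -
      have "s * ?p j = e * (s * s)" by (simp add: vj u'_def)
      moreover have "s * s > 0" using that not_real_square_gt_zero[of s] by blast
      then have "e * (s * s) > 0" using e(1) by (rule mult_pos_pos[rotated])
      ultimately show ?thesis by linarith
    qed
    ultimately show ?thesis by blast
  qed
  \<comment> \<open>The sign of \<open>s\<close> becomes the sign at \<open>j\<close>: negative
    keeps \<open>j\<close> off the side, positive puts it on.\<close>
  show "A \<in> radon_sides f (insert j C)"
    using sign[of "-1"] u(1) j(2) unfolding radon_sides_def by auto
  show "insert j A \<in> radon_sides f (insert j C)"
    using sign[of 1] u(1) j(2) unfolding radon_sides_def by auto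
qed

lemma radon_sides_extend:
  assumes C: "C \<subseteq> N" "d + 1 \<le> card C" and A: "A \<in> radon_sides f C"
    and U: "C \<union> D \<subseteq> N" "C \<inter> D = {}" "X \<subseteq> D"
  shows "A \<union> X \<in> radon_sides f (C \<union> D)"
proof -
  have "finite D" using finite_subset_N U(1) by blast
  then show ?thesis
    using U
  proof (induction D arbitrary: X rule: finite_induct)
    case empty
    then show ?case using A by simp
  next
    case (insert j D)
    have "card C \<le> card (C \<union> D)"
      using finite_subset_N[of "C \<union> D"] insert.prems(1) by (intro card_mono) auto
    then have card: "d + 1 \<le> card (C \<union> D)" using C(2) by simp
    have j: "j \<in> N" "j \<notin> C \<union> D" and sub: "C \<union> D \<subseteq> N" using insert by auto
    have IH: "A \<union> (X - {j}) \<in> radon_sides f (C \<union> D)"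
      by (rule insert.IH) (use insert.prems in auto)
    note step = radon_sides_insert[OF sub card j IH]
    show ?case
    proof (cases "j \<in> X")
      case True
      then have "A \<union> X = insert j (A \<union> (X - {j}))" by blast
      then show ?thesis using step(2) by simp
    next
      case False
      then have "A \<union> X = A \<union> (X - {j})" by blast
      then show ?thesis using step(1) by simp
    qed
  qed
qed

lemma card_radon_sides_ge:
  assumes V: "V \<subseteq> N" "card V = d + 2 + k"
  shows "(d + 2 + k) choose k \<le> card (radon_sides f V)"
proof -
  have finV: "finite V" using V(1) by (rule finite_subset_N)
  have "{Z. Z \<subseteq> V \<and> card Z = k} \<subseteq> {S. strongly_shattered (radon_sides f V) S}"
  proof safe
    fix Z assume Z: "Z \<subseteq> V" "k = card Z"
    let ?C = "V - Z"
    have C: "?C \<subseteq> N" "card ?C = d + 2"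
      using V Z finV by (auto simp: card_Diff_subset finite_subset)
    obtain u where u: "affine_dependence f ?C u" "\<And>i. i \<in> ?C \<Longrightarrow> u i \<noteq> 0"
      using circuit_exists[OF C] by blast
    \<comment> \<open>The positive part of the circuit on \<open>V - Z\<close> serves as the fixed
      part \<open>R\<close> of the subcube with directions \<open>Z\<close>.\<close>
    let ?A = "{i \<in> ?C. u i > 0}"
    have "\<forall>i\<in>?C - ?A. u i < 0" using u(2) by (auto simp: not_less less_le)
    then have A: "?A \<in> radon_sides f ?C"
      using u(1) unfolding radon_sides_def by blast
    have "?A \<union> X \<in> radon_sides f V" if "X \<subseteq> Z" for X
      using radon_sides_extend[OF C(1) _ A, of Z X] C(2) V(1) Z(1) that
      by (simp add: Un_absorb2 Int_commute)
    then show "strongly_shattered (radon_sides f V) Z"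
      unfolding strongly_shattered_def by (intro exI[of _ ?A]) auto
  qed
  moreover have "finite {S. strongly_shattered (radon_sides f V) S}"
  proof (rule finite_subset)
    show "{S. strongly_shattered (radon_sides f V) S} \<subseteq> Pow V"
      using strongly_shattered_subset_Union[of "radon_sides f V"] by (fastforce simp: radon_sides_def)
  qed (use finV in simp)
  ultimately have "card {Z. Z \<subseteq> V \<and> card Z = k} \<le> card {S. strongly_shattered (radon_sides f V) S}"
    by (intro card_mono)
  also have "\<dots> \<le> card (radon_sides f V)"
    by (rule card_strongly_shattered_le[OF finV]) (auto simp: radon_sides_def)
  finally show ?thesis using n_subsets[OF finV, of k] V(2) by simp
qed

section \<open>Relative interiors of simplices and crossings\<close>

text \<open>Barycentric coordinates are bounded linear functionals of the lifted points, so a small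
  move inside the affine hull cannot make a positive coordinate negative.\<close>

lemma rel_interior_simplexI:
  assumes A: "A \<subseteq> N" "card A \<le> d + 1" and a: "\<And>i. i \<in> A \<Longrightarrow> a i > 0" "sum a A = 1"
  shows "(\<Sum>i\<in>A. a i *\<^sub>R f i) \<in> rel_interior (convex hull (f ` A))"
proof -
  let ?g = "\<lambda>i. homogenize d (f i)"
  let ?x = "\<Sum>i\<in>A. a i *\<^sub>R f i"
  have finA: "finite A" using A(1) by (rule finite_subset_N)
  have fA: "f ` A \<subseteq> euclid d" "inj_on f A" using A(1) in_euclid inj inj_on_subset by blast+
  then have injg: "inj_on ?g A" by (auto simp: inj_on_def)
  have ind: "independent (?g ` A)"
    unfolding dependent_image_iff[OF finA injg] affine_dependence_homogenize[OF fA(1), symmetric]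
    using trivial_dependence[OF A] by blast
  have in_hull: "(\<Sum>i\<in>A. b i *\<^sub>R f i) \<in> convex hull (f ` A)" if "\<And>i. i \<in> A \<Longrightarrow> b i \<ge> 0" "sum b A = 1" for b
    using that finA by (intro convex_sum) (auto intro: hull_inc)
  \<comment> \<open>The coefficient of \<open>i\<close> is the dual functional of the independent
    lifts, bounded on \<open>euclid (Suc d)\<close>.\<close>
  have bound: "\<exists>M>0. \<forall>w. \<bar>w i\<bar> \<le> M * norm (\<Sum>k\<in>A. w k *\<^sub>R ?g k)" if i: "i \<in> A" for i
  proof -
    obtain \<phi> :: "(nat \<Rightarrow>\<^sub>0 real) \<Rightarrow> real" where \<phi>: "linear \<phi>" "\<forall>y\<in>?g ` A. \<phi> y = (if y = ?g i then 1 else 0)"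
      using linear_independent_extend[OF ind, of "\<lambda>y. if y = ?g i then 1 else 0"] by blast
    obtain M where M: "M > 0" "\<And>x. x \<in> euclid (Suc d) \<Longrightarrow> \<bar>\<phi> x\<bar> \<le> M * norm x"
      using linear_bounded_on_euclid[OF \<phi>(1)] by blast
    have "\<bar>w i\<bar> \<le> M * norm (\<Sum>k\<in>A. w k *\<^sub>R ?g k)" for w
    proof -
      have "\<phi> (\<Sum>k\<in>A. w k *\<^sub>R ?g k) = (\<Sum>k\<in>A. w k * \<phi> (?g k))"
        using \<phi>(1) by (simp add: linear_sum linear_cmul)
      also have "\<dots> = (\<Sum>k\<in>A. if k = i then w k else 0)"
        using \<phi>(2) fA(2) i by (intro sum.cong) (auto dest: inj_onD)
      also have "\<dots> = w i" using finA i by simp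
      finally have "\<phi> (\<Sum>k\<in>A. w k *\<^sub>R ?g k) = w i" .
      moreover have "(\<Sum>k\<in>A. w k *\<^sub>R ?g k) \<in> euclid (Suc d)"
        using fA(1) homogenize_in_euclid
        by (intro subspace_sum subspace_mul subspace_euclid) blast
      ultimately show ?thesis using M(2) by metis
    qed
    then show ?thesis using M(1) by blast
  qed
  then obtain M where M: "\<And>i. i \<in> A \<Longrightarrow> M i > 0"
    "\<And>i w. i \<in> A \<Longrightarrow> \<bar>w i\<bar> \<le> M i * norm (\<Sum>k\<in>A. w k *\<^sub>R ?g k)"
    by metis
  have "A \<noteq> {}" using a(2) by auto
  \<comment> \<open>Within this radius coordinate \<open>i\<close> changes by at most
    \<open>e * M i\<close>, hence by at most \<open>a i\<close>.\<close>
  define e where "e = Min ((\<lambda>i. a i / M i) ` A)"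
  have e: "e > 0" unfolding e_def using finA \<open>A \<noteq> {}\<close> a(1) M(1) by simp
  have e_le: "e * M i \<le> a i" if "i \<in> A" for i
  proof -
    have "e \<le> a i / M i" unfolding e_def using finA that by simp
    then show ?thesis using M(1)[OF that] by (simp add: field_simps)
  qed
  have "ball ?x e \<inter> affine hull (convex hull (f ` A)) \<subseteq> convex hull (f ` A)"
  proof
    fix y assume "y \<in> ball ?x e \<inter> affine hull (convex hull (f ` A))"
    then have y: "norm (?x - y) < e" "y \<in> affine hull (f ` A)"
      by (auto simp: dist_norm affine_hull_convex_hull)
    then obtain q where q: "sum q (f ` A) = 1" "(\<Sum>v\<in>f ` A. q v *\<^sub>R v) = y"
      unfolding affine_hull_finite[OF finite_imageI[OF finA]] by blast
    define b where "b i = q (f i)" for i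
    have b: "sum b A = 1" "y = (\<Sum>i\<in>A. b i *\<^sub>R f i)"
      using q fA(2) by (simp_all add: b_def sum.reindex)
    \<comment> \<open>Both coefficient families sum to 1, so the extra coordinate cancels and the
      lifted difference is the original one.\<close>
    have diff: "(\<Sum>k\<in>A. (a k - b k) *\<^sub>R ?g k) = ?x - y"
      unfolding sum_homogenize using a(2) b by (simp add: sum_subtractf scaleR_diff_left)
    have "b i \<ge> 0" if i: "i \<in> A" for i
    proof -
      have "\<bar>a i - b i\<bar> \<le> M i * norm (?x - y)"
        using M(2)[OF i, of "\<lambda>i. a i - b i"] diff by simp
      also have "\<dots> \<le> M i * e" using y(1) M(1)[OF i] by simp
      also have "\<dots> \<le> a i" using e_le[OF i] by (simp add: mult.commute)
      finally show ?thesis by linarith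
    qed
    then show "y \<in> convex hull (f ` A)" using b in_hull by auto
  qed
  moreover have "?x \<in> convex hull (f ` A)" using a by (intro in_hull) (auto intro: less_imp_le)
  ultimately show ?thesis
    unfolding mem_rel_interior using e by (intro exI[of _ "ball ?x e"]) auto
qed

lemma radon_side_crossing:
  assumes "A \<in> radon_sides f N" "card A \<le> d + 1" "card (N - A) \<le> d + 1" "N \<noteq> {}"
  shows "crossing f A (N - A)"
proof -
  have A: "A \<subseteq> N" using assms(1) by (simp add: radon_sides_def)
  obtain a b where ab: "\<forall>i\<in>A. a i > 0" "sum a A = 1"
    "\<forall>i\<in>N - A. b i > (0::real)" "sum b (N - A) = 1"
    "(\<Sum>i\<in>A. a i *\<^sub>R f i) = (\<Sum>i\<in>N - A. b i *\<^sub>R f i)"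
    by (rule radon_sides_convex_combinations[OF finite_N assms(4) assms(1)])
  have "(\<Sum>i\<in>A. a i *\<^sub>R f i) \<in> rel_interior (convex hull (f ` A))"
    using ab A assms by (intro rel_interior_simplexI) auto
  moreover have "(\<Sum>i\<in>N - A. b i *\<^sub>R f i) \<in> rel_interior (convex hull (f ` (N - A)))"
    using ab assms by (intro rel_interior_simplexI) auto
  ultimately show ?thesis
    unfolding crossing_def hyperedge_simplex_def using ab(5) by auto
qed

end

section \<open>Faces of neighborly polytopes bound Radon sides from below\<close>

text \<open>Separating the term of \<open>k\<close> and renormalizing the others places the point on
  an open segment that starts at \<open>f k\<close>. A face meeting an open segment of
  \<open>P\<close> contains its endpoints.\<close>

lemma convex_combination_in_face:
  assumes F: "F face_of P" "convex P"
    and b: "finite B" "\<forall>i\<in>B. b i > (0::real)" "sum b B = 1" "f ` B \<subseteq> P" "(\<Sum>i\<in>B. b i *\<^sub>R f i) \<in> F"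
    and k: "k \<in> B"
  shows "f k \<in> F"
proof -
  let ?x = "\<Sum>i\<in>B. b i *\<^sub>R f i"
  let ?y = "\<Sum>i\<in>B - {k}. (b i / (1 - b k)) *\<^sub>R f i"
  have sum: "sum b (B - {k}) = 1 - b k"
    using b(3) sum.remove[OF b(1) k, of b] by simp
  have x: "?x = b k *\<^sub>R f k + (\<Sum>i\<in>B - {k}. b i *\<^sub>R f i)"
    by (rule sum.remove[OF b(1) k])
  show ?thesis
  proof (cases "B = {k}")
    case True
    then show ?thesis using b(3,5) by simp
  next
    case False
    then have "B - {k} \<noteq> {}" using k by blast
    then have "sum b (B - {k}) > 0" using b(1,2) by (intro sum_pos) auto
    then have bk: "0 < b k" "b k < 1" using sum b(2) k by auto
    have "?y \<in> P"
    proof (rule convex_sum)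
      show "(\<Sum>i\<in>B - {k}. b i / (1 - b k)) = 1"
        using sum bk by (simp flip: sum_divide_distrib)
    qed (use b F(2) bk in \<open>auto simp: less_imp_le\<close>)
    have "(1 - b k) *\<^sub>R ?y = (\<Sum>i\<in>B - {k}. b i *\<^sub>R f i)"
      using bk by (simp add: scaleR_sum_right)
    then have x': "?x = (1 - (1 - b k)) *\<^sub>R f k + (1 - b k) *\<^sub>R ?y"
      using x by simp
    show ?thesis
    \<comment> \<open>The open segment is empty when its endpoints agree; then the whole combination
      equals \<open>f k\<close>.\<close>
    proof (cases "?y = f k")
      case True
      then have "?x = f k" unfolding x' by (simp flip: scaleR_add_left)
      then show ?thesis using b(5) by simp
    next
      case False
      then have "?x \<in> open_segment (f k) ?y"
        unfolding in_segment using x' bk by (intro conjI exI[of _ "1 - b k"]) auto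
      then show ?thesis
        using face_ofD[OF F(1)] b(4,5) k \<open>?y \<in> P\<close> by blast
    qed
  qed
qed

text \<open>A side with at most \<open>t\<close> points would be the vertex set of a face. The
  common point of the two hulls lies in that face and drags in the points of \<open>V - A\<close>.
  These are extreme in \<open>P\<close>, hence in the face, yet are not among its vertices.\<close>

lemma neighborly_less_card_radon_side:
  assumes P: "convex P" "neighborly t P" "polytope_vertices P = f ` N"
    and V: "inj_on f N" "V \<subseteq> N" "finite V" "V \<noteq> {}" and A: "A \<in> radon_sides f V"
  shows "t < card A"
proof (rule ccontr)
  assume "\<not> t < card A"
  have AV: "A \<subseteq> V" using A by (simp add: radon_sides_def)
  have "card (f ` A) \<le> t"
    using card_image_le[of A f] finite_subset[OF AV V(3)] \<open>\<not> t < card A\<close> by linarith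
  moreover have "f ` A \<subseteq> polytope_vertices P" using P(3) AV V(2) by blast
  ultimately obtain F where F: "F face_of P" "polytope_vertices F = f ` A"
    using P(2) unfolding neighborly_def by blast
  obtain a b where ab: "\<forall>i\<in>A. a i > 0" "sum a A = 1"
    "\<forall>i\<in>V - A. b i > (0::real)" "sum b (V - A) = 1"
    "(\<Sum>i\<in>A. a i *\<^sub>R f i) = (\<Sum>i\<in>V - A. b i *\<^sub>R f i)"
    by (rule radon_sides_convex_combinations[OF V(3,4) A])
  have "f ` A \<subseteq> F" using F(2) by (auto simp: polytope_vertices_def extreme_point_of_def)
  then have "(\<Sum>i\<in>A. a i *\<^sub>R f i) \<in> F"
    using face_of_imp_convex[OF F(1)] ab(1,2) finite_subset[OF AV V(3)]
    by (intro convex_sum) (auto simp: less_imp_le)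
  then have xF: "(\<Sum>i\<in>V - A. b i *\<^sub>R f i) \<in> F" using ab(5) by simp
  have fV: "f ` V \<subseteq> polytope_vertices P" using P(3) V(2) by blast
  then have "f ` (V - A) \<subseteq> P" by (auto simp: polytope_vertices_def extreme_point_of_def)
  have "V - A \<noteq> {}" using ab(4) by (metis sum.empty zero_neq_one)
  then obtain k where k: "k \<in> V - A" by blast
  have "f k \<in> F"
    by (rule convex_combination_in_face[OF F(1) P(1) _ ab(3,4) \<open>f ` (V - A) \<subseteq> P\<close> xF k]) (use V(3) in simp)
  moreover have "f k extreme_point_of P" using fV k by (auto simp: polytope_vertices_def)
  ultimately have "f k extreme_point_of F"
    using F(1) extreme_point_of_face by blast
  then have "f k \<in> f ` A" using F(2) by (auto simp: polytope_vertices_def)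
  then obtain i where "i \<in> A" "f k = f i" by blast
  then have "k = i" using V(1,2) k AV by (auto dest!: inj_onD)
  then show False using k \<open>i \<in> A\<close> by blast
qed

section \<open>From Radon sides of a subset to crossing pairs\<close>

context points_in_general_position
begin

text \<open>Each side \<open>A\<close> of \<open>V\<close> is completed to size \<open>r\<close> by
  any \<open>X\<close> of the right size outside \<open>V\<close>. Intersecting the union with
  \<open>V\<close> and with \<open>N - V\<close> recovers the pair, so no completed side is counted
  twice.\<close>

lemma card_balanced_radon_sides_ge:
  assumes V: "V \<subseteq> N" "d + 1 \<le> card V"
    and m: "\<And>A. A \<in> radon_sides f V \<Longrightarrow> card A \<le> r \<and> m \<le> card (N - V) choose (r - card A)"
  shows "card (radon_sides f V) * m \<le> card {A \<in> radon_sides f N. card A = r}"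
proof -
  let ?X = "\<lambda>A. {X. X \<subseteq> N - V \<and> card X = r - card A}"
  have finV: "finite V" using V(1) by (rule finite_subset_N)
  have sides: "radon_sides f V \<subseteq> Pow V" "radon_sides f N \<subseteq> Pow N" by (auto simp: radon_sides_def)
  have fin: "finite (radon_sides f V)" "finite (radon_sides f N)"
    by (rule finite_subset[OF sides(1)] finite_subset[OF sides(2)], simp add: finV finite_N)+
  have "card (radon_sides f V) * m \<le> (\<Sum>A\<in>radon_sides f V. card (?X A))"
    using sum_mono[of "radon_sides f V" "\<lambda>_. m" "\<lambda>A. card (?X A)"] m n_subsets[of "N - V"] finite_N
    by simp
  also have "\<dots> = card (SIGMA A:radon_sides f V. ?X A)"
    using fin(1) finite_N by (intro card_SigmaI[symmetric]) auto
  also have "\<dots> = card ((\<lambda>(A, X). A \<union> X) ` (SIGMA A:radon_sides f V. ?X A))"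
  proof (rule card_image[symmetric], rule inj_onI, clarify)
    fix A X B Y
    assume "A \<in> radon_sides f V" "B \<in> radon_sides f V" "X \<subseteq> N - V" "Y \<subseteq> N - V" "A \<union> X = B \<union> Y"
    then have "A \<subseteq> V" "B \<subseteq> V" using sides(1) by auto
    with \<open>X \<subseteq> N - V\<close> \<open>Y \<subseteq> N - V\<close> \<open>A \<union> X = B \<union> Y\<close> show "A = B \<and> X = Y"
      by blast
  qed
  also have "\<dots> \<le> card {A \<in> radon_sides f N. card A = r}"
  proof (rule card_mono)
    show "(\<lambda>(A, X). A \<union> X) ` (SIGMA A:radon_sides f V. ?X A) \<subseteq> {A \<in> radon_sides f N. card A = r}"
    proof clarify
      fix A X assume A: "A \<in> radon_sides f V" and X: "X \<subseteq> N - V" "card X = r - card A"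
      have N: "V \<union> (N - V) = N" using V(1) by blast
      have "A \<union> X \<in> radon_sides f (V \<union> (N - V))"
        by (rule radon_sides_extend[OF V A]) (use V X in auto)
      moreover have "card (A \<union> X) = card A + card X"
        using A X(1) sides(1) finV finite_N
        by (intro card_Un_disjoint) (auto intro: finite_subset)
      ultimately show "A \<union> X \<in> radon_sides f N \<and> card (A \<union> X) = r"
        using m[OF A] X(2) N by simp
    qed
  qed (use fin(2) in simp)
  finally show ?thesis .
qed

end

text \<open>Each balanced side forms a crossing pair with its complement, and an unordered pair has
  at most two members.\<close>

lemma card_balanced_radon_sides_le_crossing_pairs:
  assumes "points_in_general_position d f (complete_vertices d)" "d \<ge> 1"
  shows "card {A \<in> radon_sides f (complete_vertices d). card A = d} \<le> 2 * card (crossing_pairs d f)"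
proof -
  interpret points_in_general_position d f "complete_vertices d" by fact
  let ?N = "complete_vertices d"
  have N: "card ?N = 2 * d" "?N \<noteq> {}" using assms(2) by (auto simp: complete_vertices_def lessThan_empty_iff)
  have "crossing_pairs d f \<subseteq> Pow (Pow ?N)"
    unfolding crossing_pairs_def complete_hyperedges_def by auto
  then have fin: "finite (crossing_pairs d f)"
    by (rule finite_subset) (simp add: finite_N)
  have "{A \<in> radon_sides f ?N. card A = d} \<subseteq> \<Union>(crossing_pairs d f)"
  proof
    fix A assume "A \<in> {A \<in> radon_sides f ?N. card A = d}"
    then have A: "A \<in> radon_sides f ?N" "card A = d" by auto
    then have "A \<subseteq> ?N" by (simp add: radon_sides_def)
    then have card: "card (?N - A) = d"
      using A(2) N(1) finite_subset_N by (simp add: card_Diff_subset)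
    then have "crossing f A (?N - A)"
      using A N(2) by (intro radon_side_crossing) auto
    then have "{A, ?N - A} \<in> crossing_pairs d f"
      using \<open>A \<subseteq> ?N\<close> A(2) card unfolding crossing_pairs_def complete_hyperedges_def by blast
    then show "A \<in> \<Union>(crossing_pairs d f)" by blast
  qed
  then have "card {A \<in> radon_sides f ?N. card A = d} \<le> card (\<Union>(crossing_pairs d f))"
    using fin by (intro card_mono finite_Union) (auto simp: crossing_pairs_def)
  also have "\<dots> \<le> (\<Sum>p\<in>crossing_pairs d f. card p)"
    by (rule card_Union_le_sum_card)
  also have "\<dots> \<le> (\<Sum>p\<in>crossing_pairs d f. 2)"
    by (intro sum_mono) (auto simp: crossing_pairs_def card_insert_if)
  finally show ?thesis by simp
qed

section \<open>Estimates for central binomial coefficients\<close>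

text \<open>The two parts are enlarged one at a time. Symmetry swaps the lower index so that each
  enlargement changes only the upper one.\<close>

lemma central_binomial_le:
  assumes "s \<le> a" "s \<le> b"
  shows "(2 * s) choose s \<le> (a + b) choose a"
proof -
  have "(2 * s) choose s \<le> (s + b) choose s"
    using assms by (intro binomial_right_mono) simp
  also have "\<dots> = (s + b) choose b" using binomial_symmetric[of s "s + b"] by simp
  also have "\<dots> \<le> (a + b) choose b" using assms by (intro binomial_right_mono) simp
  also have "\<dots> = (a + b) choose a" using binomial_symmetric[of a "a + b"] by simp
  finally show ?thesis .
qed

text \<open>The squared inequality is proved by induction, which keeps roots out of the recursion,
  and its root is taken at the end.\<close>

lemma central_binomial_ge_sqrt:
  assumes "n \<ge> 1"
  shows "4 ^ n \<le> 2 * sqrt (real n) * real ((2 * n) choose n)"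
proof -
  have "16 ^ n \<le> 4 * real n * real ((2 * n) choose n) ^ 2"
    using assms
  proof (induction n rule: nat_induct_at_least)
    case base
    show ?case by simp
  next
    case (Suc n)
    let ?c = "real ((2 * n) choose n)" and ?c' = "real ((2 * Suc n) choose Suc n)"
    have "Suc (2 * n + 1) * ((2 * n + 1) choose n) = (Suc (2 * n + 1) choose Suc n) * Suc n"
      by (rule Suc_times_binomial_eq)
    moreover have "Suc (2 * n) * ((2 * n) choose n) = (Suc (2 * n) choose Suc n) * Suc n"
      by (rule Suc_times_binomial_eq)
    moreover have "(2 * n + 1) choose n = (Suc (2 * n) choose Suc n)"
      using binomial_symmetric[of n "2 * n + 1"] by simp
    ultimately have "(2 * Suc n choose Suc n) * Suc n = 2 * (Suc (2 * n) * ((2 * n) choose n))"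
      by (simp add: algebra_simps)
    then have rec: "?c' * (real n + 1) = 2 * (2 * real n + 1) * ?c"
      by (metis (no_types, lifting) mult.assoc add.commute of_nat_Suc of_nat_mult of_nat_numeral)
    \<comment> \<open>The induction step is multiplied by \<open>n + 1\<close> to clear the
      denominator of the recursion. It then reduces to 4n(n + 1) <= (2n + 1)^2.\<close>
    have "16 ^ Suc n * (real n + 1) \<le> 64 * (real n * (real n + 1)) * ?c ^ 2"
      using Suc.IH mult_left_mono[of "16 ^ n" "4 * real n * ?c ^ 2" "16 * (real n + 1)"]
      by (simp add: algebra_simps)
    also have "\<dots> \<le> 16 * (2 * real n + 1) ^ 2 * ?c ^ 2"
      by (intro mult_right_mono) (simp_all add: power2_eq_square algebra_simps)
    also have "\<dots> = 4 * (2 * (2 * real n + 1) * ?c) ^ 2"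
      by (simp add: power2_eq_square algebra_simps)
    also have "\<dots> = (4 * real (Suc n) * ?c' ^ 2) * (real n + 1)"
      unfolding rec[symmetric] by (simp add: power2_eq_square algebra_simps)
    finally show ?case by simp
  qed
  then have "sqrt (16 ^ n) \<le> sqrt (4 * real n * real ((2 * n) choose n) ^ 2)"
    by (rule real_sqrt_le_mono)
  moreover have "sqrt (16 ^ n) = (4::real) ^ n"
    by (rule real_sqrt_unique) (simp_all add: power2_eq_square flip: power_mult_distrib)
  ultimately show ?thesis by (simp add: real_sqrt_mult)
qed

section \<open>Assembling the lower bound\<close>

theorem theorem4:
  fixes t' :: nat
  shows "\<exists>c>0. \<exists>d0::nat. \<forall>d\<ge>d0. \<forall>f P.
    rectilinear_drawing d f \<and>
    convex_polytope d P \<and> neighborly (d div 2 - t') P \<and>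
    polytope_vertices P = f ` complete_vertices d \<longrightarrow>
    real (card (crossing_pairs d f)) \<ge> c * 2 ^ d * real d powr (5 / 2)"
proof (intro exI conjI allI impI)
  \<comment> \<open>\<open>K\<close> pays for replacing 2^d by 4^s: twice the 4 in \<open>s\<close>
    and the lost parity of \<open>d\<close> make 9. The factor 108 is 2 * 27 * 2, from the central
    binomial, the cubic bound and the two sides per pair.\<close>
  define K :: real where "K = 2 ^ (2 * t' + 9)"
  show "1 / (108 * K) > 0" by (simp add: K_def)
  fix d f P
  \<comment> \<open>This threshold makes \<open>s\<close> at least 6, so the natural-number
    subtractions below are not truncated, and it leaves room for \<open>d + 5\<close>
    vertices.\<close>
  assume d: "2 * t' + 20 \<le> d"
    and "rectilinear_drawing d f \<and> convex_polytope d P \<and> neighborly (d div 2 - t') P \<and>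
      polytope_vertices P = f ` complete_vertices d"
  then have draw: "rectilinear_drawing d f" and P: "convex_polytope d P"
    and nb: "neighborly (d div 2 - t') P" and vert: "polytope_vertices P = f ` complete_vertices d"
    by auto
  let ?N = "complete_vertices d"
  have gp: "points_in_general_position d f ?N"
    using draw rectilinear_drawing_general_position[OF draw] d
    by unfold_locales (auto simp: rectilinear_drawing_def complete_vertices_def)
  interpret points_in_general_position d f ?N by (rule gp)
  have "convex P" using P by (auto simp: convex_polytope_def polytope_def)
  define V where "V = {..<d + 5}"
  \<comment> \<open>The two bounds from neighborliness show that both \<open>d - card A\<close> and
    \<open>card A - 5\<close> are at least this \<open>s\<close>.\<close>
  define s where "s = d div 2 - t' - 4"
  have V: "V \<subseteq> ?N" "card V = d + 2 + 3" "V \<noteq> {}" "finite V"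
    using d by (auto simp: V_def complete_vertices_def lessThan_empty_iff)
  have NV: "card (?N - V) = d - 5"
    using V d by (simp add: card_Diff_subset complete_vertices_def)
  have balanced: "card A \<le> d \<and> (2 * s) choose s \<le> card (?N - V) choose (d - card A)"
    if A: "A \<in> radon_sides f V" for A
  proof -
    have "A \<subseteq> V" using A by (simp add: radon_sides_def)
    have 1: "d div 2 - t' < card A"
      by (rule neighborly_less_card_radon_side[OF \<open>convex P\<close> nb vert inj V(1,4,3) A])
    have "d div 2 - t' < card (V - A)"
      by (rule neighborly_less_card_radon_side[OF \<open>convex P\<close> nb vert inj V(1,4,3) radon_sides_complement[OF A]])
    then have 2: "d div 2 - t' + card A < d + 5"
      using V \<open>A \<subseteq> V\<close> by (simp add: card_Diff_subset finite_subset)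
    \<comment> \<open>Of the \<open>d - 5\<close> vertices outside \<open>V\<close>,
      \<open>d - card A\<close> join \<open>A\<close>, and the remaining \<open>card A - 5\<close>
      fill up the other side.\<close>
    have "(2 * s) choose s \<le> ((d - card A) + (card A - 5)) choose (d - card A)"
      using 1 2 d by (intro central_binomial_le) (auto simp: s_def)
    moreover have "(d - card A) + (card A - 5) = d - 5" using 1 2 d by linarith
    moreover have "card A \<le> d" using 2 d by linarith
    ultimately show ?thesis using NV by simp
  qed
  have "((d + 5) choose 3) * ((2 * s) choose s) \<le> card (radon_sides f V) * ((2 * s) choose s)"
    using card_radon_sides_ge[OF V(1,2)] by (intro mult_right_mono) (simp_all add: numeral_eq_Suc)
  also have "\<dots> \<le> card {A \<in> radon_sides f ?N. card A = d}"
    using V balanced by (intro card_balanced_radon_sides_ge) auto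
  also have "\<dots> \<le> 2 * card (crossing_pairs d f)"
    using d by (intro card_balanced_radon_sides_le_crossing_pairs gp) simp
  finally have count: "real ((d + 5) choose 3) * real ((2 * s) choose s) \<le> 2 * real (card (crossing_pairs d f))"
    by (metis of_nat_le_iff of_nat_mult of_nat_numeral)
  have "real d ^ 3 / 27 \<le> (real (d + 5) / real 3) ^ 3"
    by (simp add: power_divide divide_right_mono power_mono)
  also have "\<dots> \<le> real ((d + 5) choose 3)"
    by (rule binomial_ge_n_over_k_pow_k) simp
  finally have cube: "real d ^ 3 / 27 \<le> real ((d + 5) choose 3)" .
  have "(2::real) ^ d \<le> 2 ^ (2 * s + (2 * t' + 9))"
    using d by (intro power_increasing) (auto simp: s_def)
  also have "\<dots> = K * 4 ^ s" by (simp add: K_def power_add power_mult)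
  also have "4 ^ s \<le> 2 * sqrt (real s) * real ((2 * s) choose s)"
    using d by (intro central_binomial_ge_sqrt) (auto simp: s_def)
  also have "\<dots> \<le> 2 * sqrt (real d) * real ((2 * s) choose s)"
    by (intro mult_right_mono mult_left_mono) (auto simp: s_def)
  finally have central: "2 ^ d \<le> K * (2 * sqrt (real d) * real ((2 * s) choose s))"
    by (simp add: K_def)
  \<comment> \<open>The target is compared after multiplication by \<open>sqrt (real d)\<close>, so
    that the cubic and central bounds combine as products; this positive factor is cancelled at the
    end.\<close>
  have "real d powr (5 / 2) * sqrt (real d) = real d ^ 3"
    using d by (simp add: powr_half_sqrt[symmetric] powr_add[symmetric] powr_numeral)
  then have "2 ^ d * real d powr (5 / 2) * sqrt (real d) = 2 ^ d * real d ^ 3"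
    by simp
  also have "\<dots> \<le> (K * (2 * sqrt (real d) * real ((2 * s) choose s))) * (27 * real ((d + 5) choose 3))"
    using central cube by (intro mult_mono) (auto simp: K_def)
  also have "\<dots> = 54 * K * (real ((d + 5) choose 3) * real ((2 * s) choose s)) * sqrt (real d)"
    by simp
  also have "\<dots> \<le> 54 * K * (2 * real (card (crossing_pairs d f))) * sqrt (real d)"
    using count by (intro mult_right_mono mult_left_mono) (auto simp: K_def)
  finally have "2 ^ d * real d powr (5 / 2) \<le> 108 * K * real (card (crossing_pairs d f))"
    using d by (simp add: mult_le_cancel_right)
  then show "1 / (108 * K) * 2 ^ d * real d powr (5 / 2) \<le> real (card (crossing_pairs d f))"
    by (simp add: K_def field_simps)
qed

end
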